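(* Let $D$ be an $n\times n$ irreducible doubly stochastic matrix. Then $\lim_{m\to\infty}D^m$ exists if and only if $D$ is primitive. Moreover, if so, then necessarily $\lim_{m\to\infty}D^m = J_n$.
   Context: A square matrix is doubly stochastic if its entries are nonnegative reals and each row and column sums to $1$. A square matrix $A$ is reducible if there is a permutation matrix $P$ such that $P^{\intercal}AP=\begin{bmatrix} A_1 & 0 \\ A_3 & A_2 \end{bmatrix}$ with $A_1,A_2$ square (nonempty) blocks; otherwise it is irreducible. A square matrix $A$ is primitive if it is entrywise nonnegative, irreducible, and has exactly one eigenvalue, counted with multiplicity, whose modulus equals the spectral radius of $A$. $J_n$ is the $n\times n$ matrix with all entries $1/n$. *)

theory Defs
  imports "Jordan_Normal_Form.Spectral_Radius"
begin

definition nonneg_mat :: "real mat \<Rightarrow> bool" where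
  "nonneg_mat A \<longleftrightarrow> (\<forall>a \<in> elements_mat A. 0 \<le> a)"

definition doubly_stochastic :: "real mat \<Rightarrow> bool" where
  "doubly_stochastic A \<longleftrightarrow> square_mat A \<and> nonneg_mat A
     \<and> (\<forall>i < dim_row A. (\<Sum>j < dim_col A. A $$ (i, j)) = 1)
     \<and> (\<forall>j < dim_col A. (\<Sum>i < dim_row A. A $$ (i, j)) = 1)"

definition permutation_mat :: "nat \<Rightarrow> 'a :: semiring_1 mat \<Rightarrow> bool" where
  "permutation_mat n P \<longleftrightarrow>
     (\<exists>p. p permutes {..<n} \<and> P = mat n n (\<lambda>(i, j). if i = p j then 1 else 0))"

definition reducible_mat :: "'a :: semiring_1 mat \<Rightarrow> bool" where
  "reducible_mat A \<longleftrightarrow> square_mat A \<and>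
     (\<exists>P k l A\<^sub>1 A\<^sub>2 A\<^sub>3. permutation_mat (dim_row A) P
        \<and> 0 < k \<and> 0 < l
        \<and> A\<^sub>1 \<in> carrier_mat k k \<and> A\<^sub>2 \<in> carrier_mat l l \<and> A\<^sub>3 \<in> carrier_mat l k
        \<and> transpose_mat P * A * P = four_block_mat A\<^sub>1 (0\<^sub>m k l) A\<^sub>3 A\<^sub>2)"

definition irreducible_mat :: "'a :: semiring_1 mat \<Rightarrow> bool" where
  "irreducible_mat A \<longleftrightarrow> square_mat A \<and> \<not> reducible_mat A"

text \<open>Eigenvalues are those over the complex numbers, counted with algebraic multiplicity,
  i.e. with their order as roots of the characteristic polynomial.\<close>

definition primitive_mat :: "real mat \<Rightarrow> bool" where
  "primitive_mat A \<longleftrightarrow> square_mat A \<and> nonneg_mat A \<and> irreducible_mat A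
     \<and> (let B = map_mat complex_of_real A in
          (\<Sum>z \<in> {z \<in> spectrum B. cmod z = spectral_radius B}.
             Polynomial.order z (char_poly B)) = 1)"

text \<open>The type of matrices of all sizes carries no topology; convergence is that of
  matrices of one fixed size, entry by entry.\<close>

definition mat_tendsto :: "(nat \<Rightarrow> real mat) \<Rightarrow> real mat \<Rightarrow> bool" where
  "mat_tendsto X L \<longleftrightarrow>
     (\<forall>m. X m \<in> carrier_mat (dim_row L) (dim_col L))
     \<and> (\<forall>i < dim_row L. \<forall>j < dim_col L. (\<lambda>m. X m $$ (i, j)) \<longlonglongrightarrow> L $$ (i, j))"

lemma mat_tendsto_unique:
  assumes "mat_tendsto X L" and "mat_tendsto X L'"
  shows "L = L'"
proof -
  have "dim_row L = dim_row L'" "dim_col L = dim_col L'"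
    using assms unfolding mat_tendsto_def by (metis carrier_matD)+
  then show ?thesis
    using assms unfolding mat_tendsto_def by (intro eq_matI) (metis LIMSEQ_unique)+
qed

definition J_mat :: "nat \<Rightarrow> real mat" where
  "J_mat n = mat n n (\<lambda>_. 1 / real n)"

end

theory Submission
  imports Defs
begin

text \<open>
  If \<open>D\<close> is primitive, then 1 is its only eigenvalue of modulus 1, and by irreducibility the
  fixed vectors of \<open>D\<close> are the constant ones. Hence \<open>D - J\<close> has spectral radius less than 1, and
  \<open>D\<^sup>m - J = (D - J)\<^sup>m\<close> tends to 0.

  Conversely, suppose that the powers converge. The columns of the limit are fixed by \<open>D\<close>, hence
  constant, and they sum to 1, so the limit is \<open>J\<close>. An eigenvalue of modulus 1 has convergent
  powers and is therefore 1. The trace of \<open>D\<^sup>m\<close> is the sum of the \<open>m\<close>-th powers of the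
  eigenvalues and tends to the algebraic multiplicity of 1; it also tends to the trace of \<open>J\<close>,
  which is 1.
\<close>

section \<open>Entrywise form of double stochasticity and of matrix products\<close>

lemma doubly_stochasticD:
  assumes "doubly_stochastic D" "D \<in> carrier_mat n n"
  shows "\<And>i j. i < n \<Longrightarrow> j < n \<Longrightarrow> 0 \<le> D $$ (i, j)"
    and "\<And>i. i < n \<Longrightarrow> (\<Sum>j<n. D $$ (i, j)) = 1"
    and "\<And>j. j < n \<Longrightarrow> (\<Sum>i<n. D $$ (i, j)) = 1"
  using assms unfolding doubly_stochastic_def nonneg_mat_def by auto

lemma mult_mat_vec_index_sum:
  assumes "A \<in> carrier_mat n n" "v \<in> carrier_vec n" "i < n"
  shows "(A *\<^sub>v v) $ i = (\<Sum>j<n. A $$ (i, j) * v $ j)"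
  using assms by (auto simp: scalar_prod_def atLeast0LessThan intro!: sum.cong)

lemma mult_mat_index_sum:
  assumes "A \<in> carrier_mat n n" "B \<in> carrier_mat n n" "i < n" "j < n"
  shows "(A * B) $$ (i, j) = (\<Sum>k<n. A $$ (i, k) * B $$ (k, j))"
  using assms by (auto simp: scalar_prod_def atLeast0LessThan intro!: sum.cong)

section \<open>Irreducibility: closed index sets and constant fixed vectors\<close>

text \<open>Supplies the reordering that moves a chosen index set to the front: a bijection onto
  \<open>S\<close> and one onto its complement are glued together.\<close>

lemma exists_permutation_initial_segment:
  assumes S: "S \<subseteq> {..<n :: nat}"
  shows "\<exists>p. p permutes {..<n} \<and> p ` {..<card S} = S"
proof -
  let ?k = "card S"
  have fS: "finite S" using S finite_subset by blast
  have k: "?k \<le> n" using card_mono[OF _ S] by simp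
  obtain f where f: "bij_betw f {..<?k} S"
    using fS ex_bij_betw_nat_finite[OF fS] by (auto simp: atLeast0LessThan)
  have "card {?k..<n} = card ({..<n} - S)"
    using S fS by (simp add: card_Diff_subset)
  then obtain g where g: "bij_betw g {?k..<n} ({..<n} - S)"
    using finite_same_card_bij[of "{?k..<n}" "{..<n} - S"] by auto
  \<comment> \<open>Outside \<open>{..<n}\<close> the map is the identity, as
    \<open>permutes\<close> demands.\<close>
  define p where "p i = (if i \<in> {..<?k} then f i else if i \<in> {..<n} then g i else i)" for i
  have pf: "bij_betw p {..<?k} S"
    using f by (subst bij_betw_cong[of _ _ f]) (auto simp: p_def)
  have pg: "bij_betw p {?k..<n} ({..<n} - S)"
    using g by (subst bij_betw_cong[of _ _ g]) (auto simp: p_def)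
  have "bij_betw p ({..<?k} \<union> {?k..<n}) (S \<union> ({..<n} - S))"
    by (rule bij_betw_combine[OF pf pg]) auto
  moreover have "{..<?k} \<union> {?k..<n} = {..<n}" "S \<union> ({..<n} - S) = {..<n}"
    using k S by auto
  ultimately have "p permutes {..<n}"
    using k by (intro bij_imp_permutes) (auto simp: p_def)
  then show ?thesis using pf by (auto simp: bij_betw_def)
qed

text \<open>Column \<open>j\<close> of \<open>P\<close> is the unit vector at \<open>p j\<close>, so
  each of the two products collapses to a single term.\<close>

lemma permutation_mat_conjugate_index:
  fixes A :: "'a :: comm_semiring_1 mat"
  assumes A: "A \<in> carrier_mat n n" and p: "p permutes {..<n}"
    and P: "P = mat n n (\<lambda>(i, j). if i = p j then 1 else 0)"
    and i: "i < n" and j: "j < n"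
  shows "(transpose_mat P * A * P) $$ (i, j) = A $$ (p i, p j)"
proof -
  have Pc: "P \<in> carrier_mat n n" by (simp add: P)
  have pl: "p k < n" if "k < n" for k
    using permutes_in_image[OF p, of k] that by simp
  have P_index: "P $$ (k, j) = (if k = p j then 1 else 0)" if "k < n" for k
    using j that by (simp add: P)
  have row: "(transpose_mat P * A) $$ (i, k) = A $$ (p i, k)" if "k < n" for k
  proof -
    have "(transpose_mat P * A) $$ (i, k) = (\<Sum>l<n. transpose_mat P $$ (i, l) * A $$ (l, k))"
      by (rule mult_mat_index_sum) (use A Pc i that in auto)
    also have "\<dots> = (\<Sum>l<n. if l = p i then A $$ (l, k) else 0)"
      using i by (intro sum.cong) (auto simp: P)
    finally show ?thesis using pl[OF i] by simp
  qed
  have "(transpose_mat P * A * P) $$ (i, j) = (\<Sum>k<n. (transpose_mat P * A) $$ (i, k) * P $$ (k, j))"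
    by (rule mult_mat_index_sum) (use A Pc i j in auto)
  also have "\<dots> = (\<Sum>k<n. if k = p j then A $$ (p i, k) else 0)"
    using j by (intro sum.cong) (auto simp: row P_index)
  finally show ?thesis using pl[OF j] by simp
qed

text \<open>If \<open>S\<close> were proper, listing its indices first would turn the vanishing
  entries into the zero upper right block of a reducible matrix, with both diagonal blocks
  nonempty.\<close>

lemma irreducible_mat_closed_set:
  fixes A :: "'a :: comm_semiring_1 mat"
  assumes A: "A \<in> carrier_mat n n" and irr: "irreducible_mat A"
    and S: "S \<subseteq> {..<n}" "S \<noteq> {}"
    and closed: "\<And>i j. i \<in> S \<Longrightarrow> j < n \<Longrightarrow> j \<notin> S \<Longrightarrow> A $$ (i, j) = 0"
  shows "S = {..<n}"
proof (rule ccontr)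
  assume ne: "S \<noteq> {..<n}"
  obtain p where p: "p permutes {..<n}" and pS: "p ` {..<card S} = S"
    using exists_permutation_initial_segment[OF S(1)] by blast
  have fS: "finite S" using S finite_subset by blast
  define k where "k = card S"
  define l where "l = n - k"
  have k: "0 < k" using S(2) fS by (simp add: k_def card_gt_0_iff)
  have kn: "k < n" unfolding k_def
    using psubset_card_mono[of "{..<n}" S] S(1) ne by auto
  define P :: "'a mat" where "P = mat n n (\<lambda>(i, j). if i = p j then 1 else 0)"
  define C where "C = transpose_mat P * A * P"
  have "P \<in> carrier_mat n n" by (simp add: P_def)
  then have C: "C \<in> carrier_mat n n" using A by (auto simp: C_def)
  have Cij: "C $$ (i, j) = A $$ (p i, p j)" if "i < n" "j < n" for i j
    unfolding C_def by (rule permutation_mat_conjugate_index[OF A p P_def that])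
  have zero: "C $$ (i, j) = 0" if "i < k" "k \<le> j" "j < n" for i j
  proof -
    have "p i \<in> S" using pS that(1) by (auto simp: k_def)
    moreover have "p j \<notin> S"
    proof
      assume "p j \<in> S"
      then obtain i' where "i' < k" "p i' = p j" using pS unfolding k_def by (metis imageE lessThan_iff)
      then have "i' = j" using permutes_inj[OF p] by (simp add: inj_eq)
      then show False using \<open>i' < k\<close> that by simp
    qed
    moreover have "p j < n" using permutes_in_image[OF p, of j] that by simp
    ultimately show ?thesis using Cij[of i j] closed that by simp
  qed
  define A\<^sub>1 where "A\<^sub>1 = mat k k (\<lambda>(i, j). C $$ (i, j))"
  define A\<^sub>2 where "A\<^sub>2 = mat l l (\<lambda>(i, j). C $$ (i + k, j + k))"
  define A\<^sub>3 where "A\<^sub>3 = mat l k (\<lambda>(i, j). C $$ (i + k, j))"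
  have "C = four_block_mat A\<^sub>1 (0\<^sub>m k l) A\<^sub>3 A\<^sub>2"
    unfolding A\<^sub>1_def A\<^sub>2_def A\<^sub>3_def using C kn zero by (intro eq_matI) (auto simp: l_def)
  moreover have "permutation_mat (dim_row A) P" using p A by (auto simp: permutation_mat_def P_def)
  moreover have "A\<^sub>1 \<in> carrier_mat k k" "A\<^sub>2 \<in> carrier_mat l l" "A\<^sub>3 \<in> carrier_mat l k"
    by (simp_all add: A\<^sub>1_def A\<^sub>2_def A\<^sub>3_def)
  moreover have "0 < l" "square_mat A" using kn A by (simp_all add: l_def)
  ultimately have "reducible_mat A"
    unfolding reducible_mat_def C_def using k by blast
  then show False using irr by (simp add: irreducible_mat_def)
qed

text \<open>Maximum principle: a harmonic vector attains its maximum on a set that the matrix does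
  not leave.\<close>

lemma irreducible_stochastic_fixed_const:
  fixes D :: "real mat" and x :: "nat \<Rightarrow> real"
  assumes D: "D \<in> carrier_mat n n" and irr: "irreducible_mat D"
    and nonneg: "\<And>i j. i < n \<Longrightarrow> j < n \<Longrightarrow> 0 \<le> D $$ (i, j)"
    and rows: "\<And>i. i < n \<Longrightarrow> (\<Sum>j<n. D $$ (i, j)) = 1"
    and fixed: "\<And>i. i < n \<Longrightarrow> (\<Sum>j<n. D $$ (i, j) * x j) = x i"
    and i: "i < n" and j: "j < n"
  shows "x i = x j"
proof -
  define M where "M = Max (x ` {..<n})"
  have le: "x k \<le> M" if "k < n" for k using that by (auto simp: M_def)
  have "M \<in> x ` {..<n}" unfolding M_def by (rule Max_in) (use i in auto)
  then have ne: "{k. k < n \<and> x k = M} \<noteq> {}" by auto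
  have "{k. k < n \<and> x k = M} = {..<n}"
  proof (rule irreducible_mat_closed_set[OF D irr _ ne])
    fix k l assume k: "k \<in> {k. k < n \<and> x k = M}" and l: "l < n" "l \<notin> {k. k < n \<and> x k = M}"
    \<comment> \<open>The gaps \<open>M - x j\<close> are nonnegative and their weighted average at
      a maximum point is 0, so every term vanishes. A positive gap forces a zero weight.\<close>
    have "(\<Sum>j<n. D $$ (k, j) * (M - x j)) = M * (\<Sum>j<n. D $$ (k, j)) - (\<Sum>j<n. D $$ (k, j) * x j)"
      by (simp add: sum_distrib_left sum_subtractf algebra_simps)
    also have "\<dots> = 0" using rows[of k] fixed[of k] k by simp
    finally have "\<forall>j\<in>{..<n}. D $$ (k, j) * (M - x j) = 0"
      using nonneg le k by (subst (asm) sum_nonneg_eq_0_iff) auto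
    then show "D $$ (k, l) = 0" using l by auto
  qed auto
  then show ?thesis using i j by (metis (mono_tags, lifting) lessThan_iff mem_Collect_eq)
qed

text \<open>As \<open>D\<close> is real, the real and imaginary parts of a fixed vector are fixed
  separately, and the real case applies to each.\<close>

lemma irreducible_stochastic_fixed_vec_const:
  fixes D :: "real mat" and v :: "complex vec"
  assumes D: "D \<in> carrier_mat n n" and irr: "irreducible_mat D"
    and nonneg: "\<And>i j. i < n \<Longrightarrow> j < n \<Longrightarrow> 0 \<le> D $$ (i, j)"
    and rows: "\<And>i. i < n \<Longrightarrow> (\<Sum>j<n. D $$ (i, j)) = 1"
    and v: "v \<in> carrier_vec n" and fixed: "map_mat complex_of_real D *\<^sub>v v = v"
    and i: "i < n" and j: "j < n"
  shows "v $ i = v $ j"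
proof -
  have eq: "(\<Sum>l<n. complex_of_real (D $$ (k, l)) * v $ l) = v $ k" if "k < n" for k
    using mult_mat_vec_index_sum[of "map_mat complex_of_real D" n v k] D v that fixed by simp
  have "(\<Sum>l<n. D $$ (k, l) * Re (v $ l)) = Re (v $ k)"
    "(\<Sum>l<n. D $$ (k, l) * Im (v $ l)) = Im (v $ k)" if "k < n" for k
    using arg_cong[OF eq[OF that], of Re] arg_cong[OF eq[OF that], of Im] by simp_all
  note * = irreducible_stochastic_fixed_const[OF D irr nonneg rows this(1) i j]
    irreducible_stochastic_fixed_const[OF D irr nonneg rows this(2) i j]
  show ?thesis by (rule complex_eqI) (use * in auto)
qed

section \<open>Spectral radius of a stochastic matrix\<close>

text \<open>At a coordinate of largest modulus \<open>M\<close>, the eigenvalue equation bounds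
  \<open>cmod z * M\<close> by a weighted average of moduli, hence by \<open>M\<close>.\<close>

lemma eigenvalue_stochastic_norm_le_1:
  fixes D :: "real mat"
  assumes D: "D \<in> carrier_mat n n"
    and nonneg: "\<And>i j. i < n \<Longrightarrow> j < n \<Longrightarrow> 0 \<le> D $$ (i, j)"
    and rows: "\<And>i. i < n \<Longrightarrow> (\<Sum>j<n. D $$ (i, j)) = 1"
    and ev: "eigenvalue (map_mat complex_of_real D) z"
  shows "cmod z \<le> 1"
proof -
  obtain v where v: "v \<in> carrier_vec n" "v \<noteq> 0\<^sub>v n" "map_mat complex_of_real D *\<^sub>v v = z \<cdot>\<^sub>v v"
    using ev D unfolding eigenvalue_def eigenvector_def by auto
  define M where "M = Max ((\<lambda>i. cmod (v $ i)) ` {..<n})"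
  have le: "cmod (v $ k) \<le> M" if "k < n" for k using that by (auto simp: M_def)
  obtain k where k: "k < n" "v $ k \<noteq> 0" using v by (metis eq_vecI carrier_vecD index_zero_vec)
  then have Mpos: "M > 0" using le[OF k(1)] by (meson less_le_trans zero_less_norm_iff)
  have "M \<in> (\<lambda>i. cmod (v $ i)) ` {..<n}" unfolding M_def by (rule Max_in) (use k in auto)
  then obtain i where i: "i < n" "cmod (v $ i) = M" by auto
  have "z * v $ i = (\<Sum>j<n. complex_of_real (D $$ (i, j)) * v $ j)"
    using mult_mat_vec_index_sum[of "map_mat complex_of_real D" n v i] D v i by simp
  then have "cmod z * M = cmod (\<Sum>j<n. complex_of_real (D $$ (i, j)) * v $ j)"
    using i by (metis norm_mult)
  also have "\<dots> \<le> (\<Sum>j<n. cmod (complex_of_real (D $$ (i, j)) * v $ j))" by (rule norm_sum)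
  also have "\<dots> \<le> (\<Sum>j<n. D $$ (i, j) * M)"
    by (rule sum_mono) (use nonneg le i in \<open>auto simp: norm_mult intro!: mult_left_mono\<close>)
  also have "\<dots> = M" using rows[OF i(1)] by (simp flip: sum_distrib_right)
  finally show ?thesis using Mpos by simp
qed

text \<open>The all-ones vector is an eigenvector, by the row sums.\<close>

lemma eigenvalue_1_stochastic:
  fixes D :: "real mat"
  assumes D: "D \<in> carrier_mat n n" and n: "n > 0"
    and rows: "\<And>i. i < n \<Longrightarrow> (\<Sum>j<n. D $$ (i, j)) = 1"
  shows "eigenvalue (map_mat complex_of_real D) 1"
proof -
  let ?v = "vec n (\<lambda>_. 1 :: complex)"
  have "map_mat complex_of_real D *\<^sub>v ?v = ?v"
  proof (rule eq_vecI)
    fix i assume "i < dim_vec ?v"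
    then have i: "i < n" by simp
    have "(map_mat complex_of_real D *\<^sub>v ?v) $ i = (\<Sum>j<n. complex_of_real (D $$ (i, j)))"
      using mult_mat_vec_index_sum[of "map_mat complex_of_real D" n ?v i] D i by simp
    then show "(map_mat complex_of_real D *\<^sub>v ?v) $ i = ?v $ i"
      using rows[OF i] i by (simp flip: of_real_sum)
  qed (use D in auto)
  moreover have "?v \<noteq> 0\<^sub>v n" using n by (metis index_vec index_zero_vec(1) zero_neq_one)
  ultimately show ?thesis using D unfolding eigenvalue_def eigenvector_def
    by (intro exI[of _ ?v]) auto
qed

lemma spectral_radius_stochastic:
  fixes D :: "real mat"
  assumes D: "D \<in> carrier_mat n n" and n: "n > 0"
    and nonneg: "\<And>i j. i < n \<Longrightarrow> j < n \<Longrightarrow> 0 \<le> D $$ (i, j)"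
    and rows: "\<And>i. i < n \<Longrightarrow> (\<Sum>j<n. D $$ (i, j)) = 1"
  shows "spectral_radius (map_mat complex_of_real D) = 1"
proof -
  let ?B = "map_mat complex_of_real D"
  have B: "?B \<in> carrier_mat n n" using D by simp
  have "spectral_radius ?B \<le> 1"
    using spectral_radius_mem_max(1)[OF B n] eigenvalue_stochastic_norm_le_1[OF D nonneg rows]
    by (auto simp: spectrum_def)
  moreover have "1 \<le> spectral_radius ?B"
    using eigenvalue_1_stochastic[OF D n rows]
    by (intro spectral_radius_mem_max(2)[OF B n]) (force simp: spectrum_def)
  ultimately show ?thesis by simp
qed

section \<open>Powers of a matrix and their decay\<close>

text \<open>The recursion of \<open>pow_mat\<close> multiplies on the right; the limit argument for
  columns needs the factor on the left.\<close>

lemma pow_mat_Suc_left: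
  fixes A :: "'a :: semiring_1 mat"
  assumes A: "A \<in> carrier_mat n n"
  shows "A ^\<^sub>m Suc k = A * A ^\<^sub>m k"
proof (induction k)
  case 0
  then show ?case using A by simp
next
  case (Suc k)
  have "A ^\<^sub>m Suc (Suc k) = A * A ^\<^sub>m k * A" using Suc by simp
  also have "\<dots> = A * A ^\<^sub>m Suc k" using A by (simp add: assoc_mult_mat[of _ n n _ n _ n])
  finally show ?case .
qed

lemma pow_smult_mat:
  fixes A :: "'a :: comm_semiring_1 mat"
  assumes A: "A \<in> carrier_mat n n"
  shows "(c \<cdot>\<^sub>m A) ^\<^sub>m k = c ^ k \<cdot>\<^sub>m (A ^\<^sub>m k)"
proof (induction k)
  case 0
  then show ?case by (intro eq_matI) (use A in auto)
next
  case (Suc k)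
  have Ak: "A ^\<^sub>m k \<in> carrier_mat n n" using A by simp
  have "(c \<cdot>\<^sub>m A) ^\<^sub>m Suc k = (c ^ k \<cdot>\<^sub>m (A ^\<^sub>m k)) * (c \<cdot>\<^sub>m A)" using Suc by simp
  also have "\<dots> = c ^ Suc k \<cdot>\<^sub>m (A ^\<^sub>m Suc k)"
    by (intro eq_matI)
      (use A Ak in \<open>auto simp: scalar_prod_def sum_distrib_left algebra_simps intro!: sum.cong\<close>)
  finally show ?case .
qed

text \<open>Dividing by some \<open>r < 1\<close> above the spectral radius leaves a matrix
  \<open>C\<close> with bounded powers, and the factor \<open>r ^ m\<close> then forces
  decay.\<close>

lemma pow_mat_tendsto_0:
  fixes A :: "complex mat"
  assumes A: "A \<in> carrier_mat n n" and ev: "\<And>z. eigenvalue A z \<Longrightarrow> cmod z < 1"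
    and i: "i < n" and j: "j < n"
  shows "(\<lambda>m. (A ^\<^sub>m m) $$ (i, j)) \<longlonglongrightarrow> 0"
proof -
  have n: "n > 0" using i by simp
  have "spectral_radius A < 1" "0 \<le> spectral_radius A"
    using spectral_radius_mem_max(1)[OF A n] ev by (auto simp: spectrum_def)
  \<comment> \<open>Nonnegativity of the spectral radius makes \<open>r\<close> positive, so that
    dividing by it is legitimate.\<close>
  then obtain r where r: "spectral_radius A < r" "r < 1" "0 < r" by (metis dense le_less_trans)
  define C where "C = complex_of_real (1 / r) \<cdot>\<^sub>m A"
  have C: "C \<in> carrier_mat n n" using A by (simp add: C_def)
  have AC: "A = complex_of_real r \<cdot>\<^sub>m C"
    using r by (intro eq_matI) (auto simp: C_def)
  \<comment> \<open>Eigenvalues of \<open>C\<close>, multiplied by \<open>r\<close>, are eigenvalues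
    of \<open>A\<close> and so have modulus below \<open>r\<close>.\<close>
  have "cmod z < 1" if z: "eigenvalue C z" for z
  proof -
    obtain v where v: "v \<in> carrier_vec n" "v \<noteq> 0\<^sub>v n" "C *\<^sub>v v = z \<cdot>\<^sub>v v"
      using z C unfolding eigenvalue_def eigenvector_def by auto
    have "A *\<^sub>v v = complex_of_real r \<cdot>\<^sub>v (C *\<^sub>v v)"
      unfolding AC using C v(1) by (intro eq_vecI) auto
    also have "\<dots> = (complex_of_real r * z) \<cdot>\<^sub>v v"
      unfolding v(3) by (simp add: smult_smult_assoc)
    finally have "eigenvalue A (complex_of_real r * z)"
      unfolding eigenvalue_def eigenvector_def using v A by auto
    then have "cmod (complex_of_real r * z) \<le> spectral_radius A"
      by (intro spectral_radius_mem_max(2)[OF A n]) (auto simp: spectrum_def)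
    then have "r * cmod z \<le> spectral_radius A" using r by (simp add: norm_mult)
    then have "r * cmod z < r * 1" using r by linarith
    then show ?thesis using r(3) by (simp only: mult_less_cancel_left_pos)
  qed
  then have "spectral_radius C < 1"
    using spectral_radius_mem_max(1)[OF C n] by (auto simp: spectrum_def)
  from spectral_radius_jnf_norm_bound_less_1_upper_triangular[OF C this]
  obtain c where c: "\<And>k. norm_bound (C ^\<^sub>m k) c" by blast
  have bound: "cmod ((A ^\<^sub>m m) $$ (i, j)) \<le> r ^ m * c" for m
  proof -
    have "(A ^\<^sub>m m) $$ (i, j) = complex_of_real r ^ m * (C ^\<^sub>m m) $$ (i, j)"
      unfolding AC pow_smult_mat[OF C] using C i j by simp
    moreover have "cmod ((C ^\<^sub>m m) $$ (i, j)) \<le> c"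
      using c[of m] C i j unfolding norm_bound_def by auto
    ultimately show ?thesis using r by (simp add: norm_mult norm_power)
  qed
  have "(\<lambda>m. r ^ m * c) \<longlonglongrightarrow> 0 * c"
    using r by (intro tendsto_mult LIMSEQ_realpow_zero tendsto_const) auto
  then have "(\<lambda>m. r ^ m * c) \<longlonglongrightarrow> 0" by simp
  then have "(\<lambda>m. cmod ((A ^\<^sub>m m) $$ (i, j))) \<longlonglongrightarrow> 0"
    by (rule tendsto_sandwich[OF _ _ tendsto_const, rotated 2]) (simp_all add: bound)
  then show ?thesis by (rule tendsto_norm_zero_cancel)
qed

section \<open>Traces of powers as power sums of eigenvalues\<close>

text \<open>Both claims are proved in one induction, because the diagonal of the next power is
  computed from the triangular shape of the previous one.\<close>

lemma upper_triangular_pow: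
  fixes T :: "'a :: comm_semiring_1 mat"
  assumes T: "T \<in> carrier_mat n n" and ut: "upper_triangular T"
  shows "upper_triangular (T ^\<^sub>m k) \<and> (\<forall>i<n. (T ^\<^sub>m k) $$ (i, i) = T $$ (i, i) ^ k)"
proof (induction k)
  case 0
  then show ?case using T by auto
next
  case (Suc k)
  have Tk: "T ^\<^sub>m k \<in> carrier_mat n n" using T by simp
  have ent: "(T ^\<^sub>m Suc k) $$ (i, j) = (\<Sum>l<n. (T ^\<^sub>m k) $$ (i, l) * T $$ (l, j))"
    if "i < n" "j < n" for i j
    using mult_mat_index_sum[OF Tk T that] by simp
  \<comment> \<open>Covers the strictly lower entries and the off-diagonal summands of diagonal
    entries: either the left factor lies below the diagonal (\<open>l < i\<close>) or the right one
    does (\<open>j < l\<close>).\<close>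
  have z: "(T ^\<^sub>m k) $$ (i, l) * T $$ (l, j) = 0" if "j \<le> i" "i < n" "l < n" "l \<noteq> i \<or> j < i" for i j l
  proof (cases "l < i")
    case True
    then show ?thesis using Suc Tk that upper_triangularD[of "T ^\<^sub>m k" l i] by auto
  next
    case False
    then have "j < l" using that by auto
    then show ?thesis using upper_triangularD[OF ut, of j l] T that by auto
  qed
  have "(T ^\<^sub>m Suc k) $$ (i, i) = T $$ (i, i) ^ Suc k" if "i < n" for i
  proof -
    have "(T ^\<^sub>m Suc k) $$ (i, i) = (\<Sum>l<n. if l = i then (T ^\<^sub>m k) $$ (i, i) * T $$ (i, i) else 0)"
      unfolding ent[OF that that] using z that by (intro sum.cong) auto
    then show ?thesis using that Suc by (simp add: mult.commute)
  qed
  moreover have "upper_triangular (T ^\<^sub>m Suc k)"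
  proof
    fix i j assume "j < i" "i < dim_row (T ^\<^sub>m Suc k)"
    then have "i < n" "j < n" using T by auto
    then show "(T ^\<^sub>m Suc k) $$ (i, j) = 0"
      unfolding ent[OF \<open>i < n\<close> \<open>j < n\<close>] using z \<open>j < i\<close> by (intro sum.neutral) auto
  qed
  ultimately show ?case by blast
qed

lemma trace_mult_comm:
  fixes A B :: "'a :: comm_semiring_1 mat"
  assumes "A \<in> carrier_mat n n" "B \<in> carrier_mat n n"
  shows "(\<Sum>i<n. (A * B) $$ (i, i)) = (\<Sum>i<n. (B * A) $$ (i, i))"
proof -
  have "(\<Sum>i<n. (A * B) $$ (i, i)) = (\<Sum>i<n. \<Sum>k<n. A $$ (i, k) * B $$ (k, i))"
    using assms by (intro sum.cong refl mult_mat_index_sum) auto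
  also have "\<dots> = (\<Sum>k<n. \<Sum>i<n. B $$ (k, i) * A $$ (i, k))"
    by (subst sum.swap) (simp add: mult.commute)
  also have "\<dots> = (\<Sum>i<n. (B * A) $$ (i, i))"
    using assms by (intro sum.cong refl mult_mat_index_sum[symmetric]) auto
  finally show ?thesis .
qed

text \<open>Schur decomposition makes \<open>A\<close> similar to a triangular \<open>T\<close>,
  whose diagonal serves as \<open>e\<close>. It lists the eigenvalues with algebraic multiplicity,
  and traces are invariant under similarity.\<close>

lemma trace_pow_eigenvalues:
  fixes A :: "complex mat"
  assumes A: "A \<in> carrier_mat n n"
  obtains e where "char_poly A = (\<Prod>i\<leftarrow>[0..<n]. [:- e i, 1:])"
    and "\<And>m. (\<Sum>i<n. (A ^\<^sub>m m) $$ (i, i)) = (\<Sum>i<n. e i ^ m)"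
proof -
  obtain es where "char_poly A = (\<Prod>a\<leftarrow>es. [:- a, 1:])"
    using char_poly_factorized[OF A] by blast
  from schur_decomposition_exists[OF A this] obtain T where
    T: "T \<in> carrier_mat n n" "upper_triangular T" and sim: "similar_mat A T" by blast
  from sim obtain P Q where wit: "similar_mat_wit A T P Q" by (auto simp: similar_mat_def)
  note W = similar_mat_witD2[OF A wit]
  show ?thesis
  proof
    show "char_poly A = (\<Prod>i\<leftarrow>[0..<n]. [:- T $$ (i, i), 1:])"
      using char_poly_similar[OF sim] char_poly_upper_triangular[OF T] T(1)
      by (simp add: diag_mat_def o_def)
    fix m
    have Tm: "T ^\<^sub>m m \<in> carrier_mat n n" using T by simp
    \<comment> \<open>Bracketed so that the cyclic property of the trace brings \<open>Q\<close> and
      \<open>P\<close> together, where they cancel.\<close>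
    have "A ^\<^sub>m m = P * (T ^\<^sub>m m * Q)"
      using similar_mat_wit_pow_id[OF wit, of m] W Tm by (simp add: assoc_mult_mat[of _ n n _ n _ n])
    moreover have "T ^\<^sub>m m * Q \<in> carrier_mat n n" using W Tm by auto
    ultimately have "(\<Sum>i<n. (A ^\<^sub>m m) $$ (i, i)) = (\<Sum>i<n. (T ^\<^sub>m m * Q * P) $$ (i, i))"
      using trace_mult_comm[of P n "T ^\<^sub>m m * Q"] W by metis
    also have "T ^\<^sub>m m * Q * P = T ^\<^sub>m m"
      using W Tm by (simp add: assoc_mult_mat[of _ n n _ n _ n])
    finally show "(\<Sum>i<n. (A ^\<^sub>m m) $$ (i, i)) = (\<Sum>i<n. T $$ (i, i) ^ m)"
      using upper_triangular_pow[OF T] by simp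
  qed
qed

section \<open>Consequences of convergent powers\<close>

text \<open>Consecutive powers differ by \<open>z ^ m * (z - 1)\<close>, whose modulus is constantly
  \<open>cmod (z - 1)\<close>, yet convergence sends it to 0.\<close>

lemma unit_norm_power_convergent_imp_1:
  fixes z :: complex
  assumes "(\<lambda>m. z ^ m) \<longlonglongrightarrow> l" and "cmod z = 1"
  shows "z = 1"
proof -
  have "(\<lambda>m. z ^ Suc m - z ^ m) \<longlonglongrightarrow> l - l"
    by (intro tendsto_diff LIMSEQ_Suc assms(1))
  then have "(\<lambda>m. cmod (z ^ m * (z - 1))) \<longlonglongrightarrow> 0"
    by (intro tendsto_norm_zero) (simp add: algebra_simps)
  then have "(\<lambda>m :: nat. cmod (z - 1)) \<longlonglongrightarrow> 0"
    using assms(2) by (simp add: norm_mult norm_power)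
  then show ?thesis by (simp add: LIMSEQ_const_iff)
qed

text \<open>For an eigenvector \<open>v\<close>, the \<open>m\<close>-th power of \<open>A\<close>
  scales \<open>v\<close> by \<open>z ^ m\<close>; reading this at a nonzero coordinate of
  \<open>v\<close> expresses \<open>z ^ m\<close> through convergent entries.\<close>

lemma eigenvalue_pow_convergent:
  fixes A :: "complex mat"
  assumes A: "A \<in> carrier_mat n n"
    and conv: "\<And>i j. i < n \<Longrightarrow> j < n \<Longrightarrow> convergent (\<lambda>m. (A ^\<^sub>m m) $$ (i, j))"
    and ev: "eigenvalue A z"
  shows "convergent (\<lambda>m. z ^ m)"
proof -
  obtain v where e: "eigenvector A v z" using ev by (auto simp: eigenvalue_def)
  then have v: "v \<in> carrier_vec n" "v \<noteq> 0\<^sub>v n" using A by (auto simp: eigenvector_def)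
  obtain i where i: "i < n" "v $ i \<noteq> 0" using v by (metis eq_vecI carrier_vecD index_zero_vec)
  have "z ^ m * v $ i = (\<Sum>j<n. (A ^\<^sub>m m) $$ (i, j) * v $ j)" for m
    using mult_mat_vec_index_sum[of "A ^\<^sub>m m" n v i] eigenvector_pow[OF A e, of m] A v i by simp
  then have "z ^ m = (\<Sum>j<n. (A ^\<^sub>m m) $$ (i, j) * v $ j) * inverse (v $ i)" for m
    using i by (metis divide_inverse nonzero_mult_div_cancel_right)
  moreover have "convergent (\<lambda>m. (\<Sum>j<n. (A ^\<^sub>m m) $$ (i, j) * v $ j) * inverse (v $ i))"
    using i by (intro convergent_mult convergent_sum conv convergent_const) auto
  ultimately show ?thesis by simp
qed

lemma col_sum_pow_mat:
  fixes D :: "'a :: comm_semiring_1 mat"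
  assumes D: "D \<in> carrier_mat n n"
    and cols: "\<And>j. j < n \<Longrightarrow> (\<Sum>i<n. D $$ (i, j)) = 1"
    and j: "j < n"
  shows "(\<Sum>i<n. (D ^\<^sub>m m) $$ (i, j)) = 1"
  using j
proof (induction m arbitrary: j)
  case 0
  then show ?case using D by simp
next
  case (Suc m)
  have Dm: "D ^\<^sub>m m \<in> carrier_mat n n" using D by simp
  have "(\<Sum>i<n. (D ^\<^sub>m Suc m) $$ (i, j)) = (\<Sum>i<n. \<Sum>k<n. (D ^\<^sub>m m) $$ (i, k) * D $$ (k, j))"
    using mult_mat_index_sum[OF Dm D _ Suc.prems] by simp
  also have "\<dots> = (\<Sum>k<n. (\<Sum>i<n. (D ^\<^sub>m m) $$ (i, k)) * D $$ (k, j))"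
    by (subst sum.swap) (simp add: sum_distrib_right)
  also have "\<dots> = 1" using Suc cols by simp
  finally show ?case .
qed

text \<open>Passing to the limit in the left recursion shows that each column of the limit is fixed
  by \<open>D\<close>, hence constant. Column sums survive the limit and determine the
  constant.\<close>

lemma pow_limit_eq_J_mat:
  assumes D: "D \<in> carrier_mat n n" and irr: "irreducible_mat D" and ds: "doubly_stochastic D"
    and lim: "\<And>i j. i < n \<Longrightarrow> j < n \<Longrightarrow> (\<lambda>m. (D ^\<^sub>m m) $$ (i, j)) \<longlonglongrightarrow> l i j"
    and i: "i < n" and j: "j < n"
  shows "l i j = 1 / real n"
proof -
  note S = doubly_stochasticD[OF ds D]
  have const: "l k j = l i j" if k: "k < n" for k
  proof (rule irreducible_stochastic_fixed_const[OF D irr S(1,2) _ k i])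
    fix k assume k: "k < n"
    have "(D ^\<^sub>m Suc m) $$ (k, j) = (\<Sum>p<n. D $$ (k, p) * (D ^\<^sub>m m) $$ (p, j))" for m
    proof -
      have "D ^\<^sub>m Suc m = D * D ^\<^sub>m m" by (rule pow_mat_Suc_left[OF D])
      then show ?thesis using mult_mat_index_sum[OF D _ k j, of "D ^\<^sub>m m"] D by simp
    qed
    moreover have "(\<lambda>m. \<Sum>p<n. D $$ (k, p) * (D ^\<^sub>m m) $$ (p, j)) \<longlonglongrightarrow> (\<Sum>p<n. D $$ (k, p) * l p j)"
      using lim j by (intro tendsto_sum tendsto_mult tendsto_const) auto
    ultimately have "(\<lambda>m. (D ^\<^sub>m Suc m) $$ (k, j)) \<longlonglongrightarrow> (\<Sum>p<n. D $$ (k, p) * l p j)" by simp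
    then show "(\<Sum>p<n. D $$ (k, p) * l p j) = l k j"
      using LIMSEQ_unique LIMSEQ_Suc[OF lim[OF k j]] by blast
  qed auto
  have "(\<lambda>m. \<Sum>k<n. (D ^\<^sub>m m) $$ (k, j)) \<longlonglongrightarrow> (\<Sum>k<n. l k j)"
    using lim j by (intro tendsto_sum) auto
  then have "(\<Sum>k<n. l k j) = 1"
    using col_sum_pow_mat[OF D S(3) j] by (simp add: LIMSEQ_const_iff)
  moreover have "(\<Sum>k<n. l k j) = (\<Sum>k<n. l i j)" by (rule sum.cong) (use const in auto)
  ultimately show ?thesis using i by (simp add: field_simps)
qed

section \<open>From primitivity to convergence\<close>

text \<open>\<open>J_mat n\<close> is idempotent and absorbs \<open>D\<close> on both sides, so all
  mixed terms collapse to it. The exponent is a successor because at 0 the left side is the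
  identity, from which the right side still subtracts \<open>J_mat n\<close>.\<close>

lemma pow_diff_J_mat:
  assumes D: "D \<in> carrier_mat n n" and ds: "doubly_stochastic D"
  shows "(D - J_mat n) ^\<^sub>m Suc m = D ^\<^sub>m Suc m - J_mat n"
proof (induction m)
  case 0
  then show ?case using D by (simp add: J_mat_def)
next
  case (Suc m)
  let ?J = "J_mat n"
  note S = doubly_stochasticD[OF ds D]
  have J: "?J \<in> carrier_mat n n" by (simp add: J_mat_def)
  define X where "X = D ^\<^sub>m Suc m"
  have X: "X \<in> carrier_mat n n" using D by (simp add: X_def del: pow_mat.simps)
  have JD: "?J * D = ?J"
  proof (rule eq_matI)
    fix i j assume "i < dim_row ?J" "j < dim_col ?J"
    then have ij: "i < n" "j < n" using J by auto
    then show "(?J * D) $$ (i, j) = ?J $$ (i, j)"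
      using mult_mat_index_sum[OF J D ij] S(3)[OF ij(2)] by (simp add: J_mat_def flip: sum_divide_distrib)
  qed (use J D in auto)
  have JJ: "?J * ?J = ?J"
  proof (rule eq_matI)
    fix i j assume "i < dim_row ?J" "j < dim_col ?J"
    then have ij: "i < n" "j < n" using J by auto
    then show "(?J * ?J) $$ (i, j) = ?J $$ (i, j)"
      using mult_mat_index_sum[OF J J ij] by (simp add: J_mat_def)
  qed (use J in auto)
  have XJ: "D ^\<^sub>m k * ?J = ?J" for k
  proof (induction k)
    case 0
    then show ?case using J D by simp
  next
    case (Suc k)
    have DJ: "D * ?J = ?J"
    proof (rule eq_matI)
      fix i j assume "i < dim_row ?J" "j < dim_col ?J"
      then have ij: "i < n" "j < n" using J by auto
      then show "(D * ?J) $$ (i, j) = ?J $$ (i, j)"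
        using mult_mat_index_sum[OF D J ij] S(2)[OF ij(1)] by (simp add: J_mat_def flip: sum_divide_distrib)
    qed (use J D in auto)
    have "D ^\<^sub>m Suc k * ?J = D ^\<^sub>m k * (D * ?J)"
      using D J by (simp add: assoc_mult_mat[of _ n n _ n _ n])
    then show ?case using Suc DJ by simp
  qed
  have "(D - ?J) ^\<^sub>m Suc (Suc m) = (X - ?J) * (D - ?J)" using Suc by (simp add: X_def)
  also have "\<dots> = X * (D - ?J) - ?J * (D - ?J)"
    by (rule minus_mult_distrib_mat) (use X D J in auto)
  also have "\<dots> = (X * D - X * ?J) - (?J * D - ?J * ?J)"
    using mult_minus_distrib_mat[OF X D J] mult_minus_distrib_mat[OF J D J] by simp
  also have "\<dots> = D ^\<^sub>m Suc (Suc m) - ?J"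
    unfolding JD JJ using XJ[of "Suc m"] D J X by (intro eq_matI) (auto simp: X_def)
  finally show ?case .
qed

text \<open>An eigenvector of \<open>D - J\<close> for a nonzero eigenvalue has coordinate sum zero, because the
  column sums of \<open>D - J\<close> vanish; hence it is an eigenvector of \<open>D\<close> that is not constant.\<close>

lemma eigenvalue_diff_J_mat:
  assumes D: "D \<in> carrier_mat n n" and irr: "irreducible_mat D" and ds: "doubly_stochastic D"
    and ev: "eigenvalue (map_mat complex_of_real (D - J_mat n)) z" and z: "z \<noteq> 0"
  shows "eigenvalue (map_mat complex_of_real D) z \<and> z \<noteq> 1"
proof -
  note S = doubly_stochasticD[OF ds D]
  let ?B = "map_mat complex_of_real D"
  let ?E = "map_mat complex_of_real (D - J_mat n)"
  have J: "J_mat n \<in> carrier_mat n n" by (simp add: J_mat_def)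
  then have E: "?E \<in> carrier_mat n n" using D by auto
  obtain v where v: "v \<in> carrier_vec n" "v \<noteq> 0\<^sub>v n" "?E *\<^sub>v v = z \<cdot>\<^sub>v v"
    using ev E unfolding eigenvalue_def eigenvector_def by (metis carrier_matD(1))
  obtain i where i: "i < n" "v $ i \<noteq> 0" using v by (metis eq_vecI carrier_vecD index_zero_vec)
  have Ev: "z * v $ k = (\<Sum>j<n. complex_of_real (D $$ (k, j) - 1 / real n) * v $ j)" if k: "k < n" for k
  proof -
    have "z * v $ k = (?E *\<^sub>v v) $ k" unfolding v(3) using v k by simp
    also have "\<dots> = (\<Sum>j<n. ?E $$ (k, j) * v $ j)" by (rule mult_mat_vec_index_sum[OF E v(1) k])
    also have "\<dots> = (\<Sum>j<n. complex_of_real (D $$ (k, j) - 1 / real n) * v $ j)"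
      using D J k by (intro sum.cong) (auto simp: J_mat_def)
    finally show ?thesis .
  qed
  have "z * (\<Sum>k<n. v $ k) = (\<Sum>k<n. \<Sum>j<n. complex_of_real (D $$ (k, j) - 1 / real n) * v $ j)"
    by (simp add: Ev sum_distrib_left)
  also have "\<dots> = (\<Sum>j<n. complex_of_real (\<Sum>k<n. D $$ (k, j) - 1 / real n) * v $ j)"
    by (subst sum.swap) (simp add: sum_distrib_right)
  also have "\<dots> = 0" using S(3) i by (intro sum.neutral) (simp add: sum_subtractf)
  finally have sum0: "(\<Sum>k<n. v $ k) = 0" using z by simp
  have Bv: "?B *\<^sub>v v = z \<cdot>\<^sub>v v"
  proof (rule eq_vecI)
    fix k assume "k < dim_vec (z \<cdot>\<^sub>v v)"
    then have k: "k < n" using v by simp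
    have "(?B *\<^sub>v v) $ k = (\<Sum>j<n. complex_of_real (D $$ (k, j)) * v $ j)"
      using mult_mat_vec_index_sum[of ?B n v k] D v k by simp
    \<comment> \<open>The part of \<open>D\<close> removed by subtracting \<open>J_mat n\<close>
      contributes only a multiple of the coordinate sum, which is zero.\<close>
    also have "\<dots> = z * v $ k + complex_of_real (1 / real n) * (\<Sum>j<n. v $ j)"
      unfolding Ev[OF k] sum_distrib_left sum.distrib[symmetric]
      by (rule sum.cong) (simp_all add: left_diff_distrib)
    finally show "(?B *\<^sub>v v) $ k = (z \<cdot>\<^sub>v v) $ k" using sum0 k v by simp
  qed (use D v in auto)
  \<comment> \<open>For \<open>z = 1\<close> the vector would be constant; with coordinate sum zero
    it would vanish, against \<open>v $ i\<close> being nonzero.\<close>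
  have "z \<noteq> 1"
  proof
    assume "z = 1"
    then have "?B *\<^sub>v v = v" using Bv v by simp
    then have "v $ k = v $ i" if "k < n" for k
      using irreducible_stochastic_fixed_vec_const[OF D irr S(1,2) v(1) _ that i(1)] by simp
    then have "(\<Sum>k<n. v $ k) = of_nat n * v $ i" by simp
    then show False using sum0 i by simp
  qed
  then show ?thesis using Bv v D unfolding eigenvalue_def eigenvector_def by auto
qed

lemma primitive_doubly_stochastic_pow_tendsto:
  assumes n: "n > 0" and D: "D \<in> carrier_mat n n" and ds: "doubly_stochastic D"
    and prim: "primitive_mat D"
  shows "mat_tendsto (\<lambda>m. D ^\<^sub>m m) (J_mat n)"
proof -
  note S = doubly_stochasticD[OF ds D]
  let ?B = "map_mat complex_of_real D"
  let ?E = "map_mat complex_of_real (D - J_mat n)"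
  have B: "?B \<in> carrier_mat n n" using D by simp
  have J: "J_mat n \<in> carrier_mat n n" by (simp add: J_mat_def)
  then have DJ: "D - J_mat n \<in> carrier_mat n n" using D by auto
  then have E: "?E \<in> carrier_mat n n" by simp
  have irr: "irreducible_mat D" using prim by (simp add: primitive_mat_def)
  have ev1: "eigenvalue ?B 1" by (rule eigenvalue_1_stochastic[OF D n S(2)])
  have only_1: "z = 1" if z: "eigenvalue ?B z" "cmod z = 1" for z
  proof (rule ccontr)
    assume "z \<noteq> 1"
    let ?P = "{z \<in> spectrum ?B. cmod z = spectral_radius ?B}"
    have sr: "spectral_radius ?B = 1" by (rule spectral_radius_stochastic[OF D n S(1,2)])
    have pos: "1 \<le> Polynomial.order w (char_poly ?B)" if "eigenvalue ?B w" for w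
    proof -
      have "char_poly ?B \<noteq> 0" using degree_monic_char_poly[OF B] by auto
      then show ?thesis using that eigenvalue_root_char_poly[OF B] order_root[of "char_poly ?B" w]
        by (simp add: Suc_le_eq)
    qed
    \<comment> \<open>A second eigenvalue on the unit circle would raise the total multiplicity to
      at least 2, whereas primitivity makes it 1.\<close>
    have "(\<Sum>z\<in>{1, z}. Polynomial.order z (char_poly ?B)) \<le> (\<Sum>z\<in>?P. Polynomial.order z (char_poly ?B))"
      by (rule sum_mono2) (use card_finite_spectrum[OF B] z ev1 sr in \<open>auto simp: spectrum_def\<close>)
    also have "\<dots> = 1" using prim by (simp add: primitive_mat_def Let_def)
    finally show False using pos[OF z(1)] pos[OF ev1] \<open>z \<noteq> 1\<close> by simp
  qed
  have small: "cmod z < 1" if z: "eigenvalue ?E z" for z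
  \<comment> \<open>Zero is split off: constant vectors give \<open>D - J_mat n\<close> the
    eigenvalue 0, which \<open>D\<close> need not have.\<close>
  proof (cases "z = 0")
    case False
    from eigenvalue_diff_J_mat[OF D irr ds z False] have "eigenvalue ?B z" "z \<noteq> 1" by auto
    then show ?thesis
      using eigenvalue_stochastic_norm_le_1[OF D S(1,2)] only_1 by (metis less_eq_real_def)
  qed simp
  have lim: "(\<lambda>m. (D ^\<^sub>m m) $$ (i, j)) \<longlonglongrightarrow> J_mat n $$ (i, j)" if ij: "i < n" "j < n" for i j
  proof -
    have "(?E ^\<^sub>m Suc m) $$ (i, j) = complex_of_real ((D ^\<^sub>m Suc m) $$ (i, j) - J_mat n $$ (i, j))" for m
    proof -
      have "?E ^\<^sub>m Suc m = map_mat complex_of_real (D ^\<^sub>m Suc m - J_mat n)"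
        using of_real_hom.mat_hom_pow[OF DJ, of "Suc m"] pow_diff_J_mat[OF D ds] by metis
      moreover have "D ^\<^sub>m Suc m \<in> carrier_mat n n" using D by (rule pow_carrier_mat)
      ultimately show ?thesis using J ij by simp
    qed
    then have "(\<lambda>m. complex_of_real ((D ^\<^sub>m Suc m) $$ (i, j) - J_mat n $$ (i, j))) \<longlonglongrightarrow> 0"
      using LIMSEQ_Suc[OF pow_mat_tendsto_0[OF E small ij]] by simp
    then have "(\<lambda>m. (D ^\<^sub>m Suc m) $$ (i, j) - J_mat n $$ (i, j)) \<longlonglongrightarrow> 0"
      using tendsto_of_real_iff[of _ 0] by (metis of_real_0)
    \<comment> \<open>Undoes the index shift caused by the successor exponent.\<close>
    then show ?thesis by (rule LIMSEQ_imp_Suc[OF LIM_zero_cancel])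
  qed
  show ?thesis unfolding mat_tendsto_def using lim J pow_carrier_mat[OF D] by simp
qed

section \<open>From convergence to primitivity\<close>

text \<open>That 1 is the only peripheral eigenvalue leaves its algebraic multiplicity open.
  Comparing two limits of the trace settles it.\<close>

lemma pow_convergent_imp_primitive:
  assumes n: "n > 0" and D: "D \<in> carrier_mat n n" and irr: "irreducible_mat D"
    and ds: "doubly_stochastic D"
    and lim: "\<And>i j. i < n \<Longrightarrow> j < n \<Longrightarrow> (\<lambda>m. (D ^\<^sub>m m) $$ (i, j)) \<longlonglongrightarrow> l i j"
  shows "primitive_mat D"
proof -
  note S = doubly_stochasticD[OF ds D]
  let ?B = "map_mat complex_of_real D"
  have B: "?B \<in> carrier_mat n n" using D by simp
  have Bm: "(?B ^\<^sub>m m) $$ (i, j) = complex_of_real ((D ^\<^sub>m m) $$ (i, j))" if "i < n" "j < n" for m i j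
    using of_real_hom.mat_hom_pow[OF D, of m] D that by (metis index_map_mat(1) pow_mat_dim_square)
  have Blim: "(\<lambda>m. (?B ^\<^sub>m m) $$ (i, j)) \<longlonglongrightarrow> complex_of_real (1 / real n)" if "i < n" "j < n" for i j
    unfolding Bm[OF that] using lim[OF that] pow_limit_eq_J_mat[OF D irr ds lim that]
    by (metis tendsto_of_real)
  have only_1: "z = 1" if z: "eigenvalue ?B z" "cmod z = 1" for z
  proof -
    have "convergent (\<lambda>m. z ^ m)"
      by (rule eigenvalue_pow_convergent[OF B _ z(1)]) (use Blim in \<open>auto simp: convergent_def\<close>)
    then show ?thesis using unit_norm_power_convergent_imp_1 z(2) by (auto simp: convergent_def)
  qed
  have "spectral_radius ?B = 1" by (rule spectral_radius_stochastic[OF D n S(1,2)])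
  then have periph: "{z \<in> spectrum ?B. cmod z = spectral_radius ?B} = {1}"
    using only_1 eigenvalue_1_stochastic[OF D n S(2)] by (auto simp: spectrum_def)
  obtain e where e: "char_poly ?B = (\<Prod>i\<leftarrow>[0..<n]. [:- e i, 1:])"
    and tr: "\<And>m. (\<Sum>i<n. (?B ^\<^sub>m m) $$ (i, i)) = (\<Sum>i<n. e i ^ m)"
    using trace_pow_eigenvalues[OF B] by blast
  \<comment> \<open>Each \<open>e i\<close> is a root of the characteristic polynomial, so it is
    either 1 or of modulus below 1.\<close>
  have e_lim: "(\<lambda>m. e i ^ m) \<longlonglongrightarrow> (if e i = 1 then 1 else 0)" if i: "i < n" for i
  proof -
    have "poly (char_poly ?B) (e i) = 0" unfolding e poly_prod_list prod_list_zero_iff using i by auto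
    then have "eigenvalue ?B (e i)" using eigenvalue_root_char_poly[OF B] by simp
    then have "cmod (e i) < 1" if "e i \<noteq> 1"
      using eigenvalue_stochastic_norm_le_1[OF D S(1,2)] only_1 that by (metis less_eq_real_def)
    then show ?thesis by (auto intro: LIMSEQ_power_zero)
  qed
  \<comment> \<open>The order at 1 adds up over the linear factors, so it counts the indices with
    \<open>e i = 1\<close>.\<close>
  have ord: "Polynomial.order 1 (char_poly ?B) = (\<Sum>i<n. if e i = 1 then 1 else 0)"
  proof -
    have "Polynomial.order 1 (char_poly ?B) = (\<Sum>i\<leftarrow>[0..<n]. Polynomial.order 1 [:- e i, 1:])"
      unfolding e by (subst order_prod_list) (auto simp: o_def)
    also have "\<dots> = (\<Sum>i<n. Polynomial.order 1 [:- e i, 1:])"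
      by (simp add: interv_sum_list_conv_sum_set_nat atLeast0LessThan)
    also have "\<dots> = (\<Sum>i<n. if e i = 1 then 1 else 0)"
      by (intro sum.cong) (auto simp: order_linear')
    finally show ?thesis .
  qed
  have "(\<lambda>m. \<Sum>i<n. e i ^ m) \<longlonglongrightarrow> (\<Sum>i<n. if e i = 1 then 1 else 0)"
    by (intro tendsto_sum e_lim) auto
  moreover have "(\<lambda>m. \<Sum>i<n. e i ^ m) \<longlonglongrightarrow> (\<Sum>i<n. complex_of_real (1 / real n))"
    unfolding tr[symmetric] by (intro tendsto_sum Blim) auto
  ultimately have "(\<Sum>i<n. if e i = 1 then 1 else 0) = (\<Sum>i<n. complex_of_real (1 / real n))"
    by (rule LIMSEQ_unique)
  also have "\<dots> = 1" using n by simp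
  \<comment> \<open>The count arose as a complex limit; it is read back as a natural number to match
    the order.\<close>
  also have "(\<Sum>i<n. if e i = 1 then 1 else 0) = complex_of_nat (\<Sum>i<n. if e i = 1 then 1 else 0)"
    unfolding of_nat_sum by (rule sum.cong) auto
  finally have "Polynomial.order 1 (char_poly ?B) = 1" unfolding ord using of_nat_eq_1_iff by blast
  then show ?thesis
    unfolding primitive_mat_def Let_def periph using irr ds by (simp add: doubly_stochastic_def)
qed

theorem theorem4p10:
  fixes D :: "real mat" and n :: nat
  assumes "n \<ge> 1"
    and "D \<in> carrier_mat n n"
    and "irreducible_mat D"
    and "doubly_stochastic D"
  shows "((\<exists>L. mat_tendsto (\<lambda>m. D ^\<^sub>m m) L) \<longleftrightarrow> primitive_mat D)
       \<and> (primitive_mat D \<longrightarrow> mat_tendsto (\<lambda>m. D ^\<^sub>m m) (J_mat n))"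
proof -
  have n: "n > 0" using assms(1) by simp
  have "primitive_mat D" if "mat_tendsto (\<lambda>m. D ^\<^sub>m m) L" for L
  proof (rule pow_convergent_imp_primitive[OF n assms(2-4)])
    \<comment> \<open>\<open>mat_tendsto\<close> requires every power to have the shape of
      \<open>L\<close>, which forces \<open>L\<close> to be \<open>n\<close> by
      \<open>n\<close>.\<close>
    have "dim_row L = n" "dim_col L = n"
      using that assms(2) unfolding mat_tendsto_def
      by (metis carrier_matD(1) pow_mat_dim_square(1), metis carrier_matD(2) pow_mat_dim_square(2))
    then show "(\<lambda>m. (D ^\<^sub>m m) $$ (i, j)) \<longlonglongrightarrow> L $$ (i, j)" if "i < n" "j < n" for i j
      using \<open>mat_tendsto (\<lambda>m. D ^\<^sub>m m) L\<close> that unfolding mat_tendsto_def by simp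
  qed
  then show ?thesis using primitive_doubly_stochastic_pow_tendsto[OF n assms(2,4)] by blast
qed

end
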